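(* Let $q=p^r$ with $p$ prime and $r\ge1$, let $\omega$ be a primitive element of $\mathbf{F}_q$, let $d$ be a positive integer with $d<q-2$, and put $m=q-1-d$. Let $A$ be the $(q-1)\times(q-1)$ matrix $$A=\Big(\prod_{l=1}^mX_l^{\omega^{(i-1)l+j}}\Big)_{1\le i,j\le q-1}$$ over the ring of formal polynomials in $X_1,\dots,X_m$, and write its permanent as $$\mathrm{per}(A)=\sum_{\substack{(\alpha_1,\dots,\alpha_m)\in\mathbf{F}_q^m\\ \exists i,\ \alpha_i\ne0}}c_{\alpha_1\alpha_2\cdots\alpha_m}X_1^{\alpha_1}X_2^{\alpha_2}\cdots X_m^{\alpha_m}+c$$ with integer coefficients. Then the number of solutions $(x_1,\dots,x_{q-1})$ in $\mathbf{F}_q$ of the system of equations $$\begin{aligned} &x_1+\omega^{q-d-1}x_2+\omega^{2(q-d-1)}x_3+\cdots+\omega^{(q-2)(q-d-1)}x_{q-1}=0\\ &x_1+\omega^{q-d-2}x_2+\omega^{2(q-d-2)}x_3+\cdots+\omega^{(q-2)(q-d-2)}x_{q-1}=0\\ &\qquad\cdots\\ &x_1+\omega x_2+\omega^2x_3+\cdots+\omega^{q-2}x_{q-1}=0 \end{aligned}$$ (one equation $\sum_{i=1}^{q-1}\omega^{(i-1)l}x_i=0$ for each $l=1,\dots,m$) such that $x_i\ne0$ for all $i$ and $x_i\neq x_j$ for $i\ne j$ equals the constant term $c$ of $\mathrm{per}(A)$.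
   Context: $\mathbf{F}_q$ is the finite field with $q$ elements; a primitive element is a generator of $\mathbf{F}_q^\times$. Formal polynomials in one variable: $\mathbf{Z}\mathbf{F}_q[X]$ is the set of all functions $\mathbf{F}_q\to\mathbf{Z}$, with pointwise addition, pointwise multiplication by integers, and product $(f\cdot g)(x)=\sum_{u+v=x}f(u)g(v)$; $X^\alpha$ is the function equal to $1$ at $\alpha$ and $0$ elsewhere, so $X^\alpha X^\beta=X^{\alpha+\beta}$ and $X^0=1$. Formal polynomials in several variables are defined inductively as for usual polynomials: the ring of formal polynomials in $X_1,\dots,X_m$ is the commutative ring, free as a $\mathbf{Z}$-module with basis the monomials $X_1^{\alpha_1}\cdots X_m^{\alpha_m}$, $(\alpha_1,\dots,\alpha_m)\in\mathbf{F}_q^m$, with multiplication determined by adding exponents in $\mathbf{F}_q^m$ (the group ring $\mathbf{Z}[\mathbf{F}_q^m]$ of the additive group). The constant term is the coefficient of $X_1^0\cdots X_m^0=1$. The permanent of an $n\times n$ matrix $A=(a_{ij})$ over a commutative ring is $\mathrm{per}(A)=\sum_{\sigma\in S_n}\prod_{i=1}^na_{i\sigma(i)}$. *)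

theory Defs
  imports
    "HOL-Library.Poly_Mapping"
    "HOL-Library.FuncSet"
    "HOL-Library.Cardinality"
    "HOL-Combinatorics.Permutations"
    "HOL-Computational_Algebra.Primes"
begin

definition primitive_element :: "'a::field \<Rightarrow> bool" where
  "primitive_element w \<longleftrightarrow> w \<noteq> 0 \<and> range (\<lambda>k::int. w powi k) = - {0}"

text \<open>
  Formal polynomials with exponents in \<open>'a\<close> and integer coefficients, in the variables
  \<open>X\<^sub>0, X\<^sub>1, X\<^sub>2, \<dots>\<close>: the group ring over the integers of the additive group of finitely
  supported exponent vectors, whose product is convolution. The number of variables may
  depend on terms: the formal polynomials in \<open>X\<^sub>1, \<dots>, X\<^sub>m\<close> are the subring of those with
  all exponent vectors in \<open>exponents m\<close>, which is a copy of \<open>'a\<close> to the power \<open>m\<close>.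
\<close>

type_synonym 'a formal_poly = "(nat \<Rightarrow>\<^sub>0 'a) \<Rightarrow>\<^sub>0 int"

definition exponents :: "nat \<Rightarrow> (nat \<Rightarrow>\<^sub>0 'a::zero) set" where
  "exponents m = {\<alpha>. Poly_Mapping.keys \<alpha> \<subseteq> {1..m}}"

definition coefficient :: "'a::zero formal_poly \<Rightarrow> (nat \<Rightarrow>\<^sub>0 'a) \<Rightarrow> int" where
  "coefficient f \<alpha> = Poly_Mapping.lookup f \<alpha>"

definition constant_term :: "'a::zero formal_poly \<Rightarrow> int" where
  "constant_term f = coefficient f 0"

text \<open>\<open>var_power l a\<close> is the variable \<open>X\<^sub>l\<close> raised to the formal exponent \<open>a\<close>.\<close>

definition var_power :: "nat \<Rightarrow> 'a::zero \<Rightarrow> 'a formal_poly" where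
  "var_power l a = Poly_Mapping.single (Poly_Mapping.single l a) 1"

lemma var_power_zero: "var_power l (0::'a::monoid_add) = 1"
  by (simp add: var_power_def)

lemma var_power_add: "var_power l (a + b :: 'a::monoid_add) = var_power l a * var_power l b"
  by (simp add: var_power_def mult_single single_add)

lemma finite_exponents: "finite (exponents m :: (nat \<Rightarrow>\<^sub>0 'a::{finite,zero}) set)"
proof (rule inj_on_finite)
  let ?g = "\<lambda>\<alpha> :: nat \<Rightarrow>\<^sub>0 'a. restrict (Poly_Mapping.lookup \<alpha>) {1..m}"
  show "inj_on ?g (exponents m)"
  proof (rule inj_onI)
    fix \<alpha> \<beta> :: "nat \<Rightarrow>\<^sub>0 'a"
    assume ab: "\<alpha> \<in> exponents m" "\<beta> \<in> exponents m" and eq: "?g \<alpha> = ?g \<beta>"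
    show "\<alpha> = \<beta>"
    proof (rule poly_mapping_eqI)
      fix k
      show "Poly_Mapping.lookup \<alpha> k = Poly_Mapping.lookup \<beta> k"
      proof (cases "k \<in> {1..m}")
        case True
        then show ?thesis using fun_cong[OF eq, of k] by simp
      next
        case False
        then have "k \<notin> Poly_Mapping.keys \<alpha>" "k \<notin> Poly_Mapping.keys \<beta>"
          using ab by (auto simp: exponents_def)
        then show ?thesis by (simp add: in_keys_iff)
      qed
    qed
  qed
  show "?g ` exponents m \<subseteq> {1..m} \<rightarrow>\<^sub>E UNIV" by auto
  show "finite ({1..m} \<rightarrow>\<^sub>E (UNIV :: 'a set))" by (simp add: finite_PiE)
qed

definition permanent :: "nat \<Rightarrow> (nat \<Rightarrow> nat \<Rightarrow> 'b::comm_ring_1) \<Rightarrow> 'b" where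
  "permanent n A = (\<Sum>\<sigma> | \<sigma> permutes {1..n}. \<Prod>i = 1..n. A i (\<sigma> i))"

end

theory Submission
  imports Defs
begin

text \<open>
  Multiplying out the product that belongs to a permutation \<open>\<sigma>\<close> adds exponents, so \<open>\<sigma>\<close> contributes
  a single monomial with coefficient \<open>1\<close>. Its exponent of \<open>X\<^sub>l\<close> is the sum over \<open>i\<close> of
  \<open>\<omega> ^ ((i - 1) * l) * \<omega> ^ \<sigma> i\<close>, which is the left-hand side of the \<open>l\<close>-th equation at the point
  with coordinates \<open>\<omega> ^ \<sigma> i\<close>. Hence the constant term counts the permutations whose point
  solves all the equations (\<open>coefficient_sum_monomials\<close>). As only \<open>X\<^sub>1, \<dots>, X\<^sub>m\<close> occur, the permanent
  has the displayed expansion (\<open>formal_poly_expansion\<close>).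

  It remains to see that these points are exactly the \<open>x\<close> with nonzero, pairwise distinct entries,
  each arising from one permutation. Since \<open>\<omega>\<close> is primitive, \<open>j \<mapsto> \<omega> ^ j\<close> is a bijection from
  \<open>{1..q - 1}\<close> to the nonzero field elements (\<open>primitive_element_bij_betw\<close>), so that such an \<open>x\<close> is
  this bijection precomposed with a unique permutation (\<open>bij_betw_permutes_injections\<close>).
\<close>

section \<open>Powers of a primitive element\<close>

text \<open>Multiplication by \<open>w\<close> permutes the nonzero elements, so it does not change their product;
  on the other hand it multiplies the product by one factor \<open>w\<close> per element.\<close>

lemma finite_field_power_card_minus_one:
  fixes w :: "'a::{finite,field}"
  assumes "w \<noteq> 0"
  shows "w ^ (CARD('a) - 1) = 1"
proof -
  let ?U = "- {0} :: 'a set"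
  have "bij_betw (\<lambda>x. w * x) ?U ?U"
    by (rule bij_betw_byWitness[where f' = "\<lambda>x. x / w"]) (use assms in auto)
  then have "(\<Prod>x\<in>?U. w * x) = \<Prod>?U"
    by (rule prod.reindex_bij_betw)
  moreover have "(\<Prod>x\<in>?U. w * x) = w ^ card ?U * \<Prod>?U"
    by (simp add: prod.distrib)
  moreover have "\<Prod>?U \<noteq> 0"
    by simp
  moreover have "card ?U = CARD('a) - 1"
    by (simp add: Compl_eq_Diff_UNIV card_Diff_singleton)
  ultimately show ?thesis
    by simp
qed

text \<open>Exponents may be reduced modulo the number of nonzero elements, so \<open>{1..CARD('a) - 1}\<close> already
  yields all powers; as it has no more elements than there are values, no power repeats.\<close>

lemma primitive_element_bij_betw:
  fixes w :: "'a::{finite,field}"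
  assumes "primitive_element w"
  shows "bij_betw (\<lambda>j. w ^ j) {1..CARD('a) - 1} (- {0})"
proof -
  let ?n = "CARD('a) - 1"
  have w: "w \<noteq> 0" and surj: "range (\<lambda>k::int. w powi k) = - {0}"
    using assms by (auto simp: primitive_element_def)
  have card: "card (- {0::'a}) = ?n"
    by (simp add: Compl_eq_Diff_UNIV card_Diff_singleton)
  have "card (- {0::'a}) \<noteq> 0"
    using one_neq_zero[where ?'a = 'a] by (simp del: one_neq_zero) blast
  then have n: "?n > 0"
    using card by simp
  have "y \<in> (\<lambda>j. w ^ j) ` {1..?n}" if "y \<noteq> 0" for y
  proof -
    from that surj obtain k :: int where k: "y = w powi k"
      by (metis ComplI imageE singletonD)
    define j where "j = nat (k mod int ?n)"
    have j: "int j = k mod int ?n"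
      using n by (simp add: j_def)
    have "y = w powi (int ?n * (k div int ?n) + int j)"
      by (simp add: k j)
    also have "\<dots> = (w ^ ?n) powi (k div int ?n) * w ^ j"
      using w by (simp add: power_int_add power_int_mult del: of_nat_diff)
    finally have y: "y = w ^ j"
      by (simp only: finite_field_power_card_minus_one[OF w] power_int_1_left mult_1_left)
    have "int j < int ?n"
      unfolding j using n by (intro pos_mod_bound) simp
    then have "j < ?n"
      by (simp only: of_nat_less_iff)
    show ?thesis
    proof (cases "j = 0")
      case True
      \<comment> \<open>The exponent \<open>0\<close> is not in the range; \<open>CARD('a) - 1\<close> takes its place.\<close>
      then have "y = w ^ ?n"
        by (simp only: y finite_field_power_card_minus_one[OF w] power_0)
      moreover have "?n \<in> {1..?n}"
        using n by simp
      ultimately show ?thesis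
        by (rule image_eqI)
    next
      case False
      then have "j \<in> {1..?n}"
        using \<open>j < ?n\<close> by simp
      with y show ?thesis
        by (rule image_eqI)
    qed
  qed
  then have img: "(\<lambda>j. w ^ j) ` {1..?n} = - {0}"
    using w by auto
  then have "inj_on (\<lambda>j. w ^ j) {1..?n}"
    by (intro eq_card_imp_inj_on) (simp_all add: card)
  with img show ?thesis
    by (simp add: bij_betw_def)
qed

section \<open>Injections as relabelled permutations\<close>

text \<open>\<open>I\<close> and \<open>T\<close> are finite of the same size, so an injection from \<open>I\<close> to \<open>T\<close> is a bijection. Following
  it by the inverse of \<open>e\<close> permutes \<open>I\<close>.\<close>

lemma bij_betw_permutes_injections:
  assumes "finite I" and e: "bij_betw e I T"
  shows "bij_betw (\<lambda>\<sigma>. \<lambda>i\<in>I. e (\<sigma> i)) {\<sigma>. \<sigma> permutes I} {x \<in> I \<rightarrow>\<^sub>E T. inj_on x I}"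
  unfolding bij_betw_def
proof
  have inj_e: "inj_on e I"
    using e by (rule bij_betw_imp_inj_on)
  show "inj_on (\<lambda>\<sigma>. \<lambda>i\<in>I. e (\<sigma> i)) {\<sigma>. \<sigma> permutes I}"
  proof (rule inj_onI, rule ext)
    fix \<sigma> \<tau> i
    assume "\<sigma> \<in> {\<sigma>. \<sigma> permutes I}" and "\<tau> \<in> {\<sigma>. \<sigma> permutes I}"
      and eq: "(\<lambda>i\<in>I. e (\<sigma> i)) = (\<lambda>i\<in>I. e (\<tau> i))"
    then have perm: "\<sigma> permutes I" "\<tau> permutes I"
      by simp_all
    show "\<sigma> i = \<tau> i"
    proof (cases "i \<in> I")
      case True
      then have "e (\<sigma> i) = e (\<tau> i)"
        using fun_cong[OF eq, of i] by simp
      then show ?thesis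
        using True perm inj_e by (simp add: inj_on_eq_iff permutes_in_image)
    next
      case False
      then show ?thesis
        using perm by (simp add: permutes_not_in)
    qed
  qed
  show "(\<lambda>\<sigma>. \<lambda>i\<in>I. e (\<sigma> i)) ` {\<sigma>. \<sigma> permutes I} = {x \<in> I \<rightarrow>\<^sub>E T. inj_on x I}"
  proof (intro equalityI subsetI)
    fix x assume "x \<in> (\<lambda>\<sigma>. \<lambda>i\<in>I. e (\<sigma> i)) ` {\<sigma>. \<sigma> permutes I}"
    then obtain \<sigma> where \<sigma>: "\<sigma> permutes I" and x: "x = (\<lambda>i\<in>I. e (\<sigma> i))"
      by auto
    have "bij_betw (e \<circ> \<sigma>) I T"
      using permutes_imp_bij[OF \<sigma>] e by (rule bij_betw_trans)
    then have "bij_betw x I T"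
      using bij_betw_cong[of I x "e \<circ> \<sigma>" T] by (simp add: x)
    moreover have "x \<in> extensional I"
      by (simp add: x)
    ultimately show "x \<in> {x \<in> I \<rightarrow>\<^sub>E T. inj_on x I}"
      by (auto simp: PiE_def bij_betw_def)
  next
    fix x assume "x \<in> {x \<in> I \<rightarrow>\<^sub>E T. inj_on x I}"
    then have x: "x \<in> I \<rightarrow>\<^sub>E T" and inj: "inj_on x I"
      by auto
    have "x ` I = T"
    proof (rule card_subset_eq)
      show "finite T"
        using \<open>finite I\<close> bij_betw_finite[OF e] by simp
      show "x ` I \<subseteq> T"
        using x by blast
      show "card (x ` I) = card T"
        using card_image[OF inj] bij_betw_same_card[OF e] by simp
    qed
    then have "bij_betw x I T"
      using inj by (simp add: bij_betw_def)
    then have bij: "bij_betw (inv_into I e \<circ> x) I I"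
      using bij_betw_inv_into[OF e] by (rule bij_betw_trans)
    define \<sigma> where "\<sigma> i = (if i \<in> I then inv_into I e (x i) else i)" for i
    have "bij_betw \<sigma> I I"
      using bij bij_betw_cong[of I \<sigma> "inv_into I e \<circ> x" I] by (simp add: \<sigma>_def)
    then have "\<sigma> permutes I"
      by (rule bij_imp_permutes) (simp add: \<sigma>_def)
    moreover have "(\<lambda>i\<in>I. e (\<sigma> i)) = x"
    proof
      fix i
      show "(\<lambda>i\<in>I. e (\<sigma> i)) i = x i"
      proof (cases "i \<in> I")
        case True
        then have "x i \<in> T"
          using x by (rule PiE_mem[rotated])
        then show ?thesis
          using True bij_betw_inv_into_right[OF e] by (simp add: \<sigma>_def)
      next
        case False
        then show ?thesis
          using PiE_arb[OF x] by simp
      qed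
    qed
    ultimately show "x \<in> (\<lambda>\<sigma>. \<lambda>i\<in>I. e (\<sigma> i)) ` {\<sigma>. \<sigma> permutes I}"
      by blast
  qed
qed

section \<open>Monomials and coefficients\<close>

lemma prod_single_one:
  "(\<Prod>i\<in>S. Poly_Mapping.single (g i) 1)
    = (Poly_Mapping.single (\<Sum>i\<in>S. g i) 1 :: 'b::comm_monoid_add \<Rightarrow>\<^sub>0 'c::comm_semiring_1)"
  by (induction S rule: infinite_finite_induct) (simp_all add: mult_single)

lemma lookup_sum_single:
  assumes "finite S"
  shows "Poly_Mapping.lookup (\<Sum>l\<in>S. Poly_Mapping.single l (f l)) k
    = (if k \<in> S then f k else (0::'b::comm_monoid_add))"
  using assms by (simp add: lookup_sum lookup_single when_def)

lemma prod_var_power_lookup: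
  assumes "\<alpha> \<in> exponents m"
  shows "(\<Prod>l = 1..m. var_power l (Poly_Mapping.lookup \<alpha> l))
    = Poly_Mapping.single (\<alpha> :: nat \<Rightarrow>\<^sub>0 'a::comm_monoid_add) 1"
proof -
  have "(\<Sum>l = 1..m. Poly_Mapping.single l (Poly_Mapping.lookup \<alpha> l)) = \<alpha>"
    using assms
    by (intro poly_mapping_eqI) (auto simp: lookup_sum_single exponents_def in_keys_iff)
  then show ?thesis
    by (simp add: var_power_def prod_single_one)
qed

text \<open>A formal polynomial is the sum of its monomials; the one with exponent vector \<open>0\<close> is the constant
  term, and an exponent vector in \<open>exponents m\<close> is nonzero iff one of its entries in \<open>{1..m}\<close> is.\<close>

lemma formal_poly_expansion:
  fixes f :: "'a::{finite,comm_monoid_add} formal_poly"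
  assumes keys: "Poly_Mapping.keys f \<subseteq> exponents m"
  shows "f = (\<Sum>\<alpha> \<in> {\<alpha> \<in> exponents m. \<exists>i\<in>{1..m}. Poly_Mapping.lookup \<alpha> i \<noteq> 0}.
              of_int (coefficient f \<alpha>) * (\<Prod>l = 1..m. var_power l (Poly_Mapping.lookup \<alpha> l)))
           + of_int (constant_term f)"
proof -
  let ?t = "\<lambda>\<alpha>. Poly_Mapping.single \<alpha> (Poly_Mapping.lookup f \<alpha>)"
  let ?E = "exponents m :: (nat \<Rightarrow>\<^sub>0 'a) set"
  have monom: "of_int (coefficient f \<alpha>) * (\<Prod>l = 1..m. var_power l (Poly_Mapping.lookup \<alpha> l)) = ?t \<alpha>"
    if "\<alpha> \<in> ?E" for \<alpha>
    using that
    by (simp only: prod_var_power_lookup)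
      (simp add: coefficient_def flip: single_of_int add: mult_single)
  have nonzero: "{\<alpha> \<in> ?E. \<exists>i\<in>{1..m}. Poly_Mapping.lookup \<alpha> i \<noteq> 0} = ?E - {0}"
  proof -
    have "(\<exists>i\<in>{1..m}. Poly_Mapping.lookup \<alpha> i \<noteq> 0) \<longleftrightarrow> \<alpha> \<noteq> 0" if "\<alpha> \<in> ?E" for \<alpha>
    proof -
      have "Poly_Mapping.keys \<alpha> \<subseteq> {1..m}"
        using that by (simp add: exponents_def)
      then show ?thesis
        by (fastforce simp: poly_mapping_eq_iff fun_eq_iff in_keys_iff)
    qed
    then show ?thesis
      by auto
  qed
  have "f = (\<Sum>\<alpha>\<in>?E. ?t \<alpha>)"
    using keys
    by (intro poly_mapping_eqI) (auto simp: lookup_sum_single finite_exponents in_keys_iff)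
  also have "\<dots> = ?t 0 + (\<Sum>\<alpha>\<in>?E - {0}. ?t \<alpha>)"
    by (rule sum.remove[OF finite_exponents]) (simp add: exponents_def)
  also have "?t 0 = of_int (constant_term f)"
    by (simp add: constant_term_def coefficient_def flip: single_of_int)
  finally show ?thesis
    unfolding nonzero using monom by (simp add: add.commute)
qed

lemma coefficient_sum_monomials:
  assumes "finite S"
  shows "coefficient (\<Sum>s\<in>S. Poly_Mapping.single (E s) 1) \<alpha> = int (card {s \<in> S. E s = \<alpha>})"
  using assms
  by (simp add: coefficient_def lookup_sum lookup_single when_def sum.If_cases Int_def eq_commute)

section \<open>The permanent\<close>

theorem theorem4p1:
  fixes p r q d m :: nat
    and \<omega> :: "'a::{finite,field}"
    and A :: "nat \<Rightarrow> nat \<Rightarrow> 'a formal_poly"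
  assumes "prime p" and "r \<ge> 1" and "q = p ^ r"
    and "CARD('a) = q"
    and "primitive_element \<omega>"
    and "0 < d" and "d < q - 2"
    and "m = q - 1 - d"
    and "\<And>i j. i \<in> {1..q - 1} \<Longrightarrow> j \<in> {1..q - 1} \<Longrightarrow>
           A i j = (\<Prod>l = 1..m. var_power l (\<omega> ^ ((i - 1) * l + j)))"
  shows "permanent (q - 1) A =
           (\<Sum>\<alpha> \<in> {\<alpha> \<in> exponents m. \<exists>i\<in>{1..m}. Poly_Mapping.lookup \<alpha> i \<noteq> 0}.
              of_int (coefficient (permanent (q - 1) A) \<alpha>)
              * (\<Prod>l = 1..m. var_power l (Poly_Mapping.lookup \<alpha> l)))
           + of_int (constant_term (permanent (q - 1) A))
         \<and> int (card {x \<in> {1..q - 1} \<rightarrow>\<^sub>E (UNIV :: 'a set).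
              (\<forall>l\<in>{1..m}. (\<Sum>i = 1..q - 1. \<omega> ^ ((i - 1) * l) * x i) = 0)
              \<and> (\<forall>i\<in>{1..q - 1}. x i \<noteq> 0)
              \<and> (\<forall>i\<in>{1..q - 1}. \<forall>j\<in>{1..q - 1}. i \<noteq> j \<longrightarrow> x i \<noteq> x j)})
           = constant_term (permanent (q - 1) A)"
proof -
  let ?I = "{1..q - 1}"
  let ?P = "{\<sigma>. \<sigma> permutes ?I}"
  let ?lhs = "\<lambda>x l. \<Sum>i = 1..q - 1. \<omega> ^ ((i - 1) * l) * x i"
  let ?pt = "\<lambda>\<sigma>. \<lambda>i\<in>?I. \<omega> ^ \<sigma> i"
  define E where "E \<sigma> = (\<Sum>l = 1..m. Poly_Mapping.single l (?lhs (?pt \<sigma>) l))" for \<sigma>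
  have lookup_E: "Poly_Mapping.lookup (E \<sigma>) l = (if l \<in> {1..m} then ?lhs (?pt \<sigma>) l else 0)" for \<sigma> l
    unfolding E_def by (rule lookup_sum_single) simp

  have monomial: "(\<Prod>i = 1..q - 1. A i (\<sigma> i)) = Poly_Mapping.single (E \<sigma>) 1" if "\<sigma> \<in> ?P" for \<sigma>
  proof -
    have "(\<Prod>i = 1..q - 1. A i (\<sigma> i))
        = (\<Prod>i = 1..q - 1. \<Prod>l = 1..m. var_power l (\<omega> ^ ((i - 1) * l + \<sigma> i)))"
    proof (rule prod.cong[OF refl])
      fix i assume "i \<in> ?I"
      moreover from this that have "\<sigma> i \<in> ?I"
        using permutes_in_image[of \<sigma> ?I i] by simp
      ultimately show "A i (\<sigma> i) = (\<Prod>l = 1..m. var_power l (\<omega> ^ ((i - 1) * l + \<sigma> i)))"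
        by (rule assms(9))
    qed
    also have "\<dots> = Poly_Mapping.single
        (\<Sum>i = 1..q - 1. \<Sum>l = 1..m. Poly_Mapping.single l (\<omega> ^ ((i - 1) * l + \<sigma> i))) 1"
      by (simp add: var_power_def prod_single_one)
    also have "(\<Sum>i = 1..q - 1. \<Sum>l = 1..m. Poly_Mapping.single l (\<omega> ^ ((i - 1) * l + \<sigma> i))) = E \<sigma>"
      by (rule poly_mapping_eqI, unfold lookup_E)
        (auto simp: lookup_sum lookup_single when_def power_add)
    finally show ?thesis .
  qed
  have per: "permanent (q - 1) A = (\<Sum>\<sigma>\<in>?P. Poly_Mapping.single (E \<sigma>) 1)"
    unfolding permanent_def by (rule sum.cong[OF refl monomial])
  have finP: "finite ?P"
    by (simp add: finite_permutations)

  have "Poly_Mapping.keys (permanent (q - 1) A)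
      \<subseteq> (\<Union>\<sigma>\<in>?P. Poly_Mapping.keys (Poly_Mapping.single (E \<sigma>) (1::int)))"
    unfolding per by (rule keys_sum)
  moreover have "E \<sigma> \<in> exponents m" for \<sigma>
    by (auto simp: exponents_def in_keys_iff lookup_E split: if_splits)
  ultimately have "Poly_Mapping.keys (permanent (q - 1) A) \<subseteq> exponents m"
    by auto
  note expansion = formal_poly_expansion[OF this]

  let ?X = "{x \<in> ?I \<rightarrow>\<^sub>E (- {0}). inj_on x ?I}"
  have "bij_betw (\<lambda>j. \<omega> ^ j) ?I (- {0})"
    using primitive_element_bij_betw[OF assms(5)] assms(4) by simp
  then have "bij_betw ?pt ?P ?X"
    by (intro bij_betw_permutes_injections) simp_all
  then have "bij_betw ?pt {\<sigma> \<in> ?P. E \<sigma> = 0} {x \<in> ?X. \<forall>l\<in>{1..m}. ?lhs x l = 0}"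
  proof (rule bij_betw_Collect)
    fix \<sigma>
    show "(\<forall>l\<in>{1..m}. ?lhs (?pt \<sigma>) l = 0) \<longleftrightarrow> E \<sigma> = 0"
      by (auto simp: poly_mapping_eq_iff fun_eq_iff lookup_E)
  qed
  then have "card {\<sigma> \<in> ?P. E \<sigma> = 0} = card {x \<in> ?X. \<forall>l\<in>{1..m}. ?lhs x l = 0}"
    by (rule bij_betw_same_card)
  also have "{x \<in> ?X. \<forall>l\<in>{1..m}. ?lhs x l = 0}
    = {x \<in> ?I \<rightarrow>\<^sub>E UNIV. (\<forall>l\<in>{1..m}. ?lhs x l = 0) \<and> (\<forall>i\<in>?I. x i \<noteq> 0)
        \<and> (\<forall>i\<in>?I. \<forall>j\<in>?I. i \<noteq> j \<longrightarrow> x i \<noteq> x j)}"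
    by (auto simp: PiE_iff inj_on_def)
  finally have count: "constant_term (permanent (q - 1) A)
    = int (card {x \<in> ?I \<rightarrow>\<^sub>E UNIV. (\<forall>l\<in>{1..m}. ?lhs x l = 0) \<and> (\<forall>i\<in>?I. x i \<noteq> 0)
        \<and> (\<forall>i\<in>?I. \<forall>j\<in>?I. i \<noteq> j \<longrightarrow> x i \<noteq> x j)})"
    unfolding constant_term_def per coefficient_sum_monomials[OF finP] by simp
  show ?thesis
    by (intro conjI expansion count[symmetric])
qed

end
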